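(* Let $P$ be a finite atomic lattice. Then $P$ is super-atomic if and only if for every $p\in P\setminus(\mathrm{atoms}(P)\cup\{0\})$ there exist two atoms $p_1,p_2$ of $P$ with $p=p_1\vee p_2$ such that $\mathrm{supp}(p)\setminus\{p_1\}\in\mathcal{S}_P$ and $\mathrm{supp}(p)\setminus\{p_2\}\in\mathcal{S}_P$.
   Context: A finite atomic lattice is a finite lattice $P$ with least element $0$ and greatest element in which every nonzero element is a join of atoms; $\mathrm{atoms}(P)$ is its set of atoms, and $\mathrm{supp}(p)=\{a\in\mathrm{atoms}(P): a\le p\}$. Let $\mathcal{S}_P=\{\mathrm{supp}(p): p\in P\}$ (a family of subsets of $\mathrm{atoms}(P)$, which ordered by inclusion is a lattice isomorphic to $P$). For $p\in P$ let $B_p=\{T\subseteq\mathrm{supp}(p):\bigvee_{b\in T}b=p\}$. $P$ is called super-atomic if for every $p\in P\setminus(\mathrm{atoms}(P)\cup\{0\})$ and every $T\in B_p$ there exist exactly two elements $a,b\in T$ such that $a\vee b=p$. *)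

theory Defs
  imports Main
begin

text \<open>
  A finite lattice is modelled by a type of classes \<open>finite\<close> and \<open>complete_lattice\<close>: on a nonempty
  finite lattice all joins and meets exist and are uniquely determined by the order, so the
  operations \<open>Sup\<close>, \<open>Inf\<close>, \<open>bot\<close>, \<open>top\<close> carry no additional data. The lattice itself is the
  whole type, passed to predicates on lattices as a term of type \<open>'a itself\<close>.
\<close>

definition atoms :: "'a::complete_lattice set" where
  "atoms = {a. a \<noteq> bot \<and> (\<forall>x. x < a \<longrightarrow> x = bot)}"

definition atomic_lattice :: "'a::{finite,complete_lattice} itself \<Rightarrow> bool" where
  "atomic_lattice _ \<longleftrightarrow> (\<forall>p::'a. p \<noteq> bot \<longrightarrow> (\<exists>A. A \<subseteq> atoms \<and> p = Sup A))"

definition supp :: "'a::complete_lattice \<Rightarrow> 'a set" where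
  "supp p = {a \<in> atoms. a \<le> p}"

definition supports :: "'a::complete_lattice set set" where
  "supports = {supp p | p. p \<in> UNIV}"

definition atom_bases :: "'a::complete_lattice \<Rightarrow> 'a set set" where
  "atom_bases p = {T. T \<subseteq> supp p \<and> Sup T = p}"

text \<open>
  "Exactly two elements of \<open>T\<close> whose join is \<open>p\<close>" means that exactly one unordered pair
  of distinct elements of \<open>T\<close> has join \<open>p\<close>.
\<close>

definition super_atomic :: "'a::{finite,complete_lattice} itself \<Rightarrow> bool" where
  "super_atomic _ \<longleftrightarrow>
    (\<forall>p::'a. p \<in> UNIV - (atoms \<union> {bot}) \<longrightarrow>
      (\<forall>T \<in> atom_bases p.
        \<exists>a \<in> T. \<exists>b \<in> T. a \<noteq> b \<and> sup a b = p \<and>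
          (\<forall>c \<in> T. \<forall>d \<in> T. c \<noteq> d \<and> sup c d = p \<longrightarrow> {c, d} = {a, b})))"

end

theory Submission
  imports Defs
begin

text \<open>
  For an atom \<open>a \<le> p\<close>, the set \<open>supp p - {a}\<close> is a support exactly when its join is not \<open>p\<close>,
  that is, exactly when \<open>a\<close> belongs to every \<open>T \<in> atom_bases p\<close>. If \<open>P\<close> is super-atomic and
  \<open>{a, b}\<close> is the unique pair in \<open>supp p\<close> with join \<open>p\<close>, then \<open>supp p - {a}\<close> contains no such pair
  and so is not a base. Conversely, if \<open>p1\<close> and \<open>p2\<close> lie in every base of \<open>p\<close>, then they lie in
  every pair with join \<open>p\<close>, since such a pair is itself a base.
\<close>

text \<open>Atomicity enters only through this fact: a set of atoms with join \<open>p\<close> lies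
  inside \<open>supp p\<close>, so the join of \<open>supp p\<close> cannot fall below
  \<open>p\<close>.\<close>

lemma supp_in_atom_bases:
  fixes p :: "'a::{finite,complete_lattice}"
  assumes "atomic_lattice TYPE('a)"
  shows "supp p \<in> atom_bases p"
proof -
  have "p \<le> Sup (supp p)"
  proof (cases "p = bot")
    case False
    then obtain A where A: "A \<subseteq> atoms" "p = Sup A"
      using assms unfolding atomic_lattice_def by blast
    then have "A \<subseteq> supp p"
      by (auto simp: supp_def intro: Sup_upper)
    then show ?thesis
      using A(2) by (simp add: Sup_subset_mono)
  qed simp
  moreover have "Sup (supp p) \<le> p"
    by (rule Sup_least) (simp add: supp_def)
  ultimately show ?thesis
    by (simp add: atom_bases_def order_antisym)
qed

lemma supp_remove_in_supports_iff:
  fixes p :: "'a::{finite,complete_lattice}"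
  assumes "atomic_lattice TYPE('a)" and "a \<in> supp p"
  shows "supp p - {a} \<in> supports \<longleftrightarrow> (\<forall>T \<in> atom_bases p. a \<in> T)"
proof
  assume "supp p - {a} \<in> supports"
  then obtain q where q: "supp p - {a} = supp q"
    by (auto simp: supports_def)
  show "\<forall>T \<in> atom_bases p. a \<in> T"
  proof (rule ballI, rule ccontr)
    \<comment> \<open>A base avoiding \<open>a\<close> would lie in \<open>supp q\<close>, forcing
      \<open>a \<le> p \<le> q\<close>.\<close>
    fix T assume T: "T \<in> atom_bases p" and "a \<notin> T"
    then have "T \<subseteq> supp q"
      unfolding q[symmetric] by (auto simp: atom_bases_def)
    then have "Sup T \<le> q"
      by (intro Sup_least) (auto simp: supp_def)
    then have "p \<le> q"
      using T by (simp add: atom_bases_def)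
    then have "a \<in> supp q"
      using assms(2) by (auto simp: supp_def)
    then show False
      using q by blast
  qed
next
  assume all: "\<forall>T \<in> atom_bases p. a \<in> T"
  \<comment> \<open>The only candidate: by atomicity an element is the join of its support.\<close>
  define q where "q = Sup (supp p - {a})"
  have p: "Sup (supp p) = p"
    using supp_in_atom_bases[OF assms(1)] by (simp add: atom_bases_def)
  have "q \<le> p"
    unfolding q_def by (rule Sup_least) (simp add: supp_def)
  moreover have "q \<noteq> p"
    using all unfolding q_def atom_bases_def by blast
  \<comment> \<open>If \<open>a \<le> q\<close>, then \<open>q\<close> bounds all of
    \<open>supp p\<close>, hence \<open>p\<close>; this contradicts \<open>q < p\<close>.\<close>
  moreover have "p \<le> q" if "a \<le> q"
  proof -
    have "x \<le> q" if "x \<in> supp p" for x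
      using that \<open>a \<le> q\<close> unfolding q_def by (cases "x = a") (auto intro: Sup_upper)
    then show ?thesis
      using p Sup_least by metis
  qed
  ultimately have "\<not> a \<le> q"
    by auto
  have "supp q = supp p - {a}"
  proof
    show "supp q \<subseteq> supp p - {a}"
      using \<open>q \<le> p\<close> \<open>\<not> a \<le> q\<close> by (auto simp: supp_def)
    show "supp p - {a} \<subseteq> supp q"
      unfolding q_def by (auto simp: supp_def intro!: Sup_upper)
  qed
  then show "supp p - {a} \<in> supports"
    unfolding supports_def by blast
qed

theorem theorem4p1:
  assumes "atomic_lattice TYPE('a::{finite,complete_lattice})"
  shows "super_atomic TYPE('a) \<longleftrightarrow>
    (\<forall>p::'a. p \<in> UNIV - (atoms \<union> {bot}) \<longrightarrow>
      (\<exists>p1 \<in> atoms. \<exists>p2 \<in> atoms. p1 \<noteq> p2 \<and> p = sup p1 p2 \<and>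
        supp p - {p1} \<in> supports \<and> supp p - {p2} \<in> supports))"
    (is "_ \<longleftrightarrow> ?R")
proof
  assume sa: "super_atomic TYPE('a)"
  show ?R
  proof (intro allI impI)
    fix p :: 'a assume p: "p \<in> UNIV - (atoms \<union> {bot})"
    have base: "\<exists>a \<in> T. \<exists>b \<in> T. a \<noteq> b \<and> sup a b = p \<and>
        (\<forall>c \<in> T. \<forall>d \<in> T. c \<noteq> d \<and> sup c d = p \<longrightarrow> {c, d} = {a, b})"
      if "T \<in> atom_bases p" for T
      using sa p that unfolding super_atomic_def by blast
    obtain a b where ab: "a \<in> supp p" "b \<in> supp p" "a \<noteq> b" "sup a b = p"
      and uniq: "\<forall>c \<in> supp p. \<forall>d \<in> supp p. c \<noteq> d \<and> sup c d = p \<longrightarrow> {c, d} = {a, b}"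
      using base[OF supp_in_atom_bases[OF assms]] by blast
    \<comment> \<open>\<open>supp p\<close> is the largest base, so the pair found in any other base
      \<open>T\<close> is also a pair in \<open>supp p\<close> and must be
      \<open>{a, b}\<close>.\<close>
    have mem: "a \<in> T \<and> b \<in> T" if T: "T \<in> atom_bases p" for T
    proof -
      obtain c d where cd: "c \<in> T" "d \<in> T" "c \<noteq> d" "sup c d = p"
        using base[OF T] by blast
      moreover have "T \<subseteq> supp p"
        using T by (simp add: atom_bases_def)
      ultimately have "{c, d} = {a, b}"
        using uniq by blast
      then show ?thesis
        using cd by (auto simp: doubleton_eq_iff)
    qed
    have "supp p - {a} \<in> supports" "supp p - {b} \<in> supports"
      using ab mem by (simp_all add: supp_remove_in_supports_iff[OF assms])
    moreover have "a \<in> atoms" "b \<in> atoms"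
      using ab by (simp_all add: supp_def)
    ultimately show "\<exists>p1 \<in> atoms. \<exists>p2 \<in> atoms. p1 \<noteq> p2 \<and> p = sup p1 p2 \<and>
        supp p - {p1} \<in> supports \<and> supp p - {p2} \<in> supports"
      using ab by blast
  qed
next
  assume R: ?R
  show "super_atomic TYPE('a)"
    unfolding super_atomic_def
  proof (intro allI impI ballI)
    fix p :: 'a and T
    assume "p \<in> UNIV - (atoms \<union> {bot})" and T: "T \<in> atom_bases p"
    then obtain a b where ab: "a \<in> atoms" "b \<in> atoms" "a \<noteq> b" "p = sup a b"
      and s: "supp p - {a} \<in> supports" "supp p - {b} \<in> supports"
      using R by blast
    have "a \<in> supp p" "b \<in> supp p"
      using ab by (simp_all add: supp_def)
    then have mem: "a \<in> U \<and> b \<in> U" if "U \<in> atom_bases p" for U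
      using s that by (simp add: supp_remove_in_supports_iff[OF assms])
    have "{c, d} = {a, b}" if "c \<in> T" "d \<in> T" "sup c d = p" for c d
    proof -
      have "{c, d} \<in> atom_bases p"
        using that T by (auto simp: atom_bases_def)
      \<comment> \<open>The base \<open>{c, d}\<close> contains the distinct elements
        \<open>a\<close> and \<open>b\<close>, which therefore exhaust it.\<close>
      then show ?thesis
        using mem ab(3) by blast
    qed
    then show "\<exists>a \<in> T. \<exists>b \<in> T. a \<noteq> b \<and> sup a b = p \<and>
        (\<forall>c \<in> T. \<forall>d \<in> T. c \<noteq> d \<and> sup c d = p \<longrightarrow> {c, d} = {a, b})"
      using mem[OF T] ab by blast
  qed
qed

end
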